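(* Let $k\ge 1$ be an integer and let $(P_{k,n})_{n\ge0}$ be the generalized $k$-Pell-Tribonacci sequence. For every integer $n\geq 0$, $$\sum_{i=0}^{n}P_{k,i}^2=\frac{a_1P_{k,n+3}^2+a_2P_{k,n+2}^2+a_3P_{k,n+1}^2}{-3k(k+2)}-\frac{b_1P_{k,n+1}P_{k,n+2}+b_2P_{k,n+2}P_{k,n+3}+b_3P_{k,n+1}P_{k,n+3}+c_1}{3k(k+2)},$$ where $a_1=1$, $a_2=4k^2+4k+1$, $a_3=3k^2+6k+1$, $b_1=2k-2$, $b_2=-4k-2$, $b_3=-2$, and $c_1=-1$.
   Context: For an integer $k\geq 1$, the generalized $k$-Pell-Tribonacci sequence $(P_{k,n})_{n\ge 0}$ is defined by $P_{k,0}=0$, $P_{k,1}=1$, $P_{k,2}=2k$ and $P_{k,n}=2kP_{k,n-1}+kP_{k,n-2}+P_{k,n-3}$ for $n\geq 3$. *)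

theory Defs
  imports Complex_Main
begin

fun pell_tribonacci :: "int \<Rightarrow> nat \<Rightarrow> int" where
  "pell_tribonacci k 0 = 0"
| "pell_tribonacci k (Suc 0) = 1"
| "pell_tribonacci k (Suc (Suc 0)) = 2 * k"
| "pell_tribonacci k (Suc (Suc (Suc n))) =
     2 * k * pell_tribonacci k (Suc (Suc n)) + k * pell_tribonacci k (Suc n) + pell_tribonacci k n"

end

theory Submission
  imports Defs
begin

text \<open>
  Let \<open>Q n\<close> be the quadratic form with coefficients \<open>a\<^sub>i, b\<^sub>i\<close> in the terms \<open>n + 1\<close>, \<open>n + 2\<close>, \<open>n + 3\<close>.
  The recurrence makes \<open>Q (n + 1) - Q n\<close> collapse to \<open>- 3k(k + 2) P\<^bsub>n+1\<^esub>\<^sup>2\<close>, and \<open>Q 0 = 1\<close>,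
  so the sum telescopes.
\<close>

lemma pell_tribonacci_sum_squares:
  "3 * k * (k + 2) * (\<Sum>i = 0..n. (pell_tribonacci k i)\<^sup>2) =
     1 - ((pell_tribonacci k (n + 3))\<^sup>2
        + (4 * k\<^sup>2 + 4 * k + 1) * (pell_tribonacci k (n + 2))\<^sup>2
        + (3 * k\<^sup>2 + 6 * k + 1) * (pell_tribonacci k (n + 1))\<^sup>2
        + (2 * k - 2) * pell_tribonacci k (n + 1) * pell_tribonacci k (n + 2)
        + (- 4 * k - 2) * pell_tribonacci k (n + 2) * pell_tribonacci k (n + 3)
        - 2 * pell_tribonacci k (n + 1) * pell_tribonacci k (n + 3))"
proof (induction n)
  case 0
  show ?case
    by (simp add: numeral_eq_Suc) algebra
next
  case (Suc n)
  have rec: "pell_tribonacci k (n + 4) =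
      2 * k * pell_tribonacci k (n + 3) + k * pell_tribonacci k (n + 2) + pell_tribonacci k (n + 1)"
    by (simp add: numeral_eq_Suc)
  have shift: "Suc n + 3 = n + 4" "Suc n + 2 = n + 3" "Suc n + 1 = n + 2"
    by simp_all
  have "3 * k * (k + 2) * (\<Sum>i = 0..Suc n. (pell_tribonacci k i)\<^sup>2) =
      3 * k * (k + 2) * (\<Sum>i = 0..n. (pell_tribonacci k i)\<^sup>2)
      + 3 * k * (k + 2) * (pell_tribonacci k (n + 1))\<^sup>2"
    by (simp add: distrib_left)
  \<comment> \<open>Once \<open>rec\<close> eliminates the term at \<open>n + 4\<close>, what
    remains is a polynomial identity in \<open>k\<close> and the terms at \<open>n + 1\<close>,
    \<open>n + 2\<close>, \<open>n + 3\<close>, which act as independent variables.\<close>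
  then show ?case
    unfolding Suc.IH shift rec by algebra
qed

theorem proposition4:
  fixes k :: int and n :: nat
    and P :: "nat \<Rightarrow> real"
    and a\<^sub>1 a\<^sub>2 a\<^sub>3 b\<^sub>1 b\<^sub>2 b\<^sub>3 c\<^sub>1 :: real
  assumes "k \<ge> 1"
    and "P = (\<lambda>i. real_of_int (pell_tribonacci k i))"
    and "a\<^sub>1 = 1"
    and "a\<^sub>2 = 4 * real_of_int k ^ 2 + 4 * real_of_int k + 1"
    and "a\<^sub>3 = 3 * real_of_int k ^ 2 + 6 * real_of_int k + 1"
    and "b\<^sub>1 = 2 * real_of_int k - 2"
    and "b\<^sub>2 = - 4 * real_of_int k - 2"
    and "b\<^sub>3 = - 2"
    and "c\<^sub>1 = - 1"
  shows "(\<Sum>i = 0..n. P i ^ 2) =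
    (a\<^sub>1 * P (n + 3) ^ 2 + a\<^sub>2 * P (n + 2) ^ 2 + a\<^sub>3 * P (n + 1) ^ 2)
      / (- 3 * real_of_int k * (real_of_int k + 2))
    - (b\<^sub>1 * P (n + 1) * P (n + 2) + b\<^sub>2 * P (n + 2) * P (n + 3) + b\<^sub>3 * P (n + 1) * P (n + 3) + c\<^sub>1)
      / (3 * real_of_int k * (real_of_int k + 2))"
proof -
  define D where "D = 3 * real_of_int k * (real_of_int k + 2)"
  have "D \<noteq> 0"
    using \<open>k \<ge> 1\<close> by (simp add: D_def)
  moreover have neg_D: "- 3 * real_of_int k * (real_of_int k + 2) = - D"
    by (simp add: D_def)
  \<comment> \<open>The integer identity is cast to the reals; its constant 1, the value of the
    quadratic form at index 0, appears here as \<open>- c\<^sub>1\<close>.\<close>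
  moreover have "D * (\<Sum>i = 0..n. P i ^ 2) =
      - (a\<^sub>1 * P (n + 3) ^ 2 + a\<^sub>2 * P (n + 2) ^ 2 + a\<^sub>3 * P (n + 1) ^ 2)
      - (b\<^sub>1 * P (n + 1) * P (n + 2) + b\<^sub>2 * P (n + 2) * P (n + 3) + b\<^sub>3 * P (n + 1) * P (n + 3) + c\<^sub>1)"
    using arg_cong[OF pell_tribonacci_sum_squares[of k n], of real_of_int]
    unfolding assms(2-) D_def by simp
  ultimately show ?thesis
    \<comment> \<open>The sign of the first denominator moves into its numerator, so both fractions
      merge over \<open>D\<close>, and clearing the nonzero \<open>D\<close> leaves the identity
      just proved.\<close>
    unfolding neg_D D_def[symmetric] divide_minus_right minus_divide_left diff_divide_distrib[symmetric]
    by (simp add: nonzero_eq_divide_eq mult.commute[of _ D])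
qed

end
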